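(* Consider the modulated classical harmonic oscillator system $\frac{dx}{dt}=A_\epsilon(c,k,\phi)x$ described in the context. If the modulation frequencies $a$ and $b$ are distinct, then the system with $c,k>0$ is never posed at a first order asymptotic exceptional point.
   Context: Harmonic oscillator: for damping constant $c$, spring constant $k$ with $c^2\ne4k$, phase shift $\phi\in\mathbb{R}$, period $T>0$ and positive integers $a,b$ with $\gcd(a,b)=1$, put $\alpha=\sqrt{c^2-4k}$, $\zeta(t)=\cos(\frac{2\pi}{T}at)$, $\kappa(t)=\cos(\frac{2\pi}{T}bt+\phi)$, and $A_\epsilon=A_0+\epsilon A_1(t)$ with $$A_0=\begin{pmatrix}-\frac{c+\alpha}{2}&0\\0&-\frac{c-\alpha}{2}\end{pmatrix},\quad A_1(t)=\frac{\kappa(t)}{\alpha}\begin{pmatrix}1&\frac{(c+\alpha)^2}{4k}\\\frac{(c-\alpha)^2}{4k}&-1\end{pmatrix}+\frac{\zeta(t)}{2}\begin{pmatrix}-1-\frac{c}{\alpha}&-1-\frac{c}{\alpha}\\-1+\frac{c}{\alpha}&-1+\frac{c}{\alpha}\end{pmatrix}.$$ (This is the first order form, with diagonalized leading order, of $x''+(c+\epsilon\zeta(t))x'+(k+\epsilon\kappa(t))x=0$.) Let $F_0$ be the diagonal matrix with diagonal entries of $A_0-F_0$ in $\frac{2\pi \mathrm{i}}{T}\mathbb{Z}$ and imaginary parts of its diagonal entries in $(-\frac{\pi}{T},\frac{\pi}{T}]$. The fundamental solution has a decomposition $X_\epsilon(t)=P_\epsilon(t)\exp(F_\epsilon t)$,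 analytic in $\epsilon$ near $0$, with $P_\epsilon$ $T$-periodic in $t$, $P_\epsilon(0)=\mathrm{Id}$, $F_\epsilon=F_0+\epsilon F_1+\ldots$ and $P_\epsilon|_{\epsilon=0}(t)=\exp((A_0-F_0)t)$. The system is posed at a first order asymptotic exceptional point if $F_0+\epsilon F_1$ is not diagonalizable for all $\epsilon>0$. *)

theory Defs
  imports "HOL-Analysis.Analysis"
begin

(* Powers and exponential of square matrices; the library's exp is not
   available because the multiplication of type vec is componentwise. *)
definition matrix_power :: "complex^'n^'n \<Rightarrow> nat \<Rightarrow> complex^'n^'n" where
  "matrix_power M n = (((**) M) ^^ n) (mat 1)"

definition matrix_exp :: "complex^'n^'n \<Rightarrow> complex^'n^'n" where
  "matrix_exp M = (\<Sum>n. (1 / fact n) *\<^sub>R matrix_power M n)"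

definition diagonal_matrix :: "complex^'n^'n \<Rightarrow> bool" where
  "diagonal_matrix M \<longleftrightarrow> (\<forall>i j. i \<noteq> j \<longrightarrow> M $ i $ j = 0)"

definition diagonalizable :: "complex^'n^'n \<Rightarrow> bool" where
  "diagonalizable M \<longleftrightarrow>
     (\<exists>S D :: complex^'n^'n. invertible S \<and> diagonal_matrix D \<and> M = S ** D ** matrix_inv S)"

definition fundamental_solution ::
    "(real \<Rightarrow> complex^'n^'n) \<Rightarrow> (real \<Rightarrow> complex^'n^'n) \<Rightarrow> bool" where
  "fundamental_solution A X \<longleftrightarrow>
     X 0 = mat 1 \<and> (\<forall>t. (X has_vector_derivative (A t ** X t)) (at t))"

(* F0 is the folded part of the diagonal matrix A0. These conditions determine F0 uniquely. *)
definition folding :: "real \<Rightarrow> complex^'n^'n \<Rightarrow> complex^'n^'n \<Rightarrow> bool" where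
  "folding T A0 F0 \<longleftrightarrow> diagonal_matrix F0 \<and>
     (\<forall>i. (\<exists>m::int. A0 $ i $ i - F0 $ i $ i = 2 * of_real pi * \<i> / of_real T * of_int m) \<and>
          - pi / T < Im (F0 $ i $ i) \<and> Im (F0 $ i $ i) \<le> pi / T)"

(* Fc is the sequence of coefficients F_0, F_1, ... of the Floquet exponent of
   x' = (A0 + \<epsilon> A1(t)) x, and Pc t that of the periodic factor P at time t. *)
definition floquet_exponent_expansion ::
    "real \<Rightarrow> complex^'n^'n \<Rightarrow> (real \<Rightarrow> complex^'n^'n) \<Rightarrow> (nat \<Rightarrow> complex^'n^'n) \<Rightarrow> bool" where
  "floquet_exponent_expansion T A0 A1 Fc \<longleftrightarrow>
     folding T A0 (Fc 0) \<and>
     (\<exists>F P Pc. \<exists>r>0.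
        (\<forall>\<epsilon>::real. \<bar>\<epsilon>\<bar> < r \<longrightarrow>
           (\<lambda>n. \<epsilon> ^ n *\<^sub>R Fc n) sums F \<epsilon> \<and>
           (\<forall>t::real. (\<lambda>n. \<epsilon> ^ n *\<^sub>R Pc t n) sums P \<epsilon> t) \<and>
           (\<forall>t. P \<epsilon> (t + T) = P \<epsilon> t) \<and>
           P \<epsilon> 0 = mat 1 \<and>
           fundamental_solution (\<lambda>t. A0 + \<epsilon> *\<^sub>R A1 t) (\<lambda>t. P \<epsilon> t ** matrix_exp (t *\<^sub>R F \<epsilon>))) \<and>
        (\<forall>t. P 0 t = matrix_exp (t *\<^sub>R (A0 - Fc 0))))"

definition first_order_asymptotic_exceptional_point ::
    "real \<Rightarrow> complex^'n^'n \<Rightarrow> (real \<Rightarrow> complex^'n^'n) \<Rightarrow> bool" where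
  "first_order_asymptotic_exceptional_point T A0 A1 \<longleftrightarrow>
     (\<exists>Fc. floquet_exponent_expansion T A0 A1 Fc \<and>
           (\<forall>\<epsilon>>0. \<not> diagonalizable (Fc 0 + \<epsilon> *\<^sub>R Fc 1)))"

definition osc_alpha :: "real \<Rightarrow> real \<Rightarrow> complex" where
  "osc_alpha c k = csqrt (of_real (c\<^sup>2 - 4 * k))"

definition osc_zeta :: "real \<Rightarrow> nat \<Rightarrow> real \<Rightarrow> real" where
  "osc_zeta T a t = cos (2 * pi / T * real a * t)"

definition osc_kappa :: "real \<Rightarrow> nat \<Rightarrow> real \<Rightarrow> real \<Rightarrow> real" where
  "osc_kappa T b \<phi> t = cos (2 * pi / T * real b * t + \<phi>)"

definition osc_A0 :: "real \<Rightarrow> real \<Rightarrow> complex^2^2" where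
  "osc_A0 c k = (let \<gamma> = complex_of_real c; \<alpha> = osc_alpha c k in
     vector [vector [- ((\<gamma> + \<alpha>) / 2), 0],
             vector [0, - ((\<gamma> - \<alpha>) / 2)]])"

(* The source obtains A0 + \<epsilon> A1(t) from x'' + (c + \<epsilon> \<zeta>(t)) x' + (k + \<epsilon> \<kappa>(t)) x = 0 by
   diagonalizing the companion matrix at \<epsilon> = 0. The matrix is the one displayed there; carrying out the
   change of basis gives the lower left entry of the \<kappa>-part the opposite sign. *)
definition osc_A1 ::
    "real \<Rightarrow> nat \<Rightarrow> nat \<Rightarrow> real \<Rightarrow> real \<Rightarrow> real \<Rightarrow> real \<Rightarrow> complex^2^2" where
  "osc_A1 T a b c k \<phi> t =
     (let \<gamma> = complex_of_real c; \<alpha> = osc_alpha c k;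
          \<zeta> = complex_of_real (osc_zeta T a t); \<kappa> = complex_of_real (osc_kappa T b \<phi> t) in
      mat (\<kappa> / \<alpha>) **
        vector [vector [1, (\<gamma> + \<alpha>)\<^sup>2 / (4 * of_real k)],
                vector [(\<gamma> - \<alpha>)\<^sup>2 / (4 * of_real k), - 1]] +
      mat (\<zeta> / 2) **
        vector [vector [- 1 - \<gamma> / \<alpha>, - 1 - \<gamma> / \<alpha>],
                vector [- 1 + \<gamma> / \<alpha>, - 1 + \<gamma> / \<alpha>]])"

end

theory Submission
  imports Defs
begin

text \<open>
  Why no first order exceptional point occurs. If the two diagonal entries of \<open>F\<^sub>0\<close> differ, then
  \<open>F\<^sub>0 + \<epsilon> F\<^sub>1\<close> has distinct eigenvalues for small \<open>\<epsilon> > 0\<close> and is diagonalizable there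
  (\<open>exists_diagonalizable_if_distinct\<close>). So the interesting case is \<open>F\<^sub>0 = f I\<close>, which forces
  \<open>\<alpha> = 2 \<pi> \<i> m / T\<close> for an integer \<open>m\<close>.

  In that case \<open>F\<^sub>1\<close> is an explicit average (\<open>first_order_floquet_exponent\<close>): with
  \<open>\<lambda>\<^sub>i\<close> the diagonal entries of \<open>A\<^sub>0\<close>, the entry \<open>(F\<^sub>1)\<^sub>i\<^sub>j\<close> is the mean over one
  period of \<open>exp ((\<lambda>\<^sub>j - \<lambda>\<^sub>i) t) (A\<^sub>1)\<^sub>i\<^sub>j\<close>. It is read off from the monodromy matrix
  \<open>X\<^sub>\<epsilon>(T) = exp (T F\<^sub>\<epsilon>)\<close> by differentiating at \<open>\<epsilon> = 0\<close> in two ways: through the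
  differential equation (\<open>first_order_perturbation\<close>), and through the exponential, which is easy to
  differentiate at a scalar matrix (\<open>has_vector_derivative_matrix_exp_at_scalar\<close>). Working with the
  monodromy matrix alone means that nothing has to be known about how the power series of
  \<open>P\<^sub>\<epsilon>(t)\<close> depends on \<open>t\<close>.

  The entries of \<open>A\<^sub>1\<close> are combinations of cosines of frequencies \<open>a, b > 0\<close>. Hence the
  diagonal of \<open>F\<^sub>1\<close> vanishes, and an off-diagonal entry is a combination, with non-zero
  coefficients, of one contribution present only when \<open>\<bar>m\<bar> = a\<close> and one present only when
  \<open>\<bar>m\<bar> = b\<close>. As \<open>a \<noteq> b\<close>, these cannot cancel (\<open>two_resonances_eq_0_iff\<close>), so the two
  off-diagonal entries are both zero or both non-zero. Either way \<open>F\<^sub>0 + \<epsilon> F\<^sub>1\<close> is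
  diagonalizable for every \<open>\<epsilon>\<close>.
\<close>

section \<open>Derivatives from quadratic remainders\<close>

lemma has_derivative_if_quadratic_remainder:
  fixes f :: "'a::real_normed_vector \<Rightarrow> 'b::real_normed_vector"
  assumes "bounded_linear D" and "d > 0"
    and "\<And>h. norm h < d \<Longrightarrow> norm (f (x + h) - f x - D h) \<le> C * (norm h)\<^sup>2"
  shows "(f has_derivative D) (at x)"
  unfolding has_derivative_at
proof (intro conjI)
  show "bounded_linear D" by fact
  have lim: "((\<lambda>h. C * norm h) \<longlongrightarrow> 0) (at (0::'a))"
    by (auto intro!: tendsto_eq_intros)
  show "(\<lambda>h. norm (f (x + h) - f x - D h) / norm h) \<midarrow>0\<rightarrow> 0"
  proof (rule tendsto_sandwich[OF _ _ tendsto_const lim])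
    show "\<forall>\<^sub>F h in at 0. norm (f (x + h) - f x - D h) / norm h \<le> C * norm h"
      using assms(3) unfolding eventually_at
      by (intro exI[of _ d]) (auto simp: assms(2) divide_simps power2_eq_square mult.assoc)
  qed auto
qed

lemma has_vector_derivative_if_quadratic_remainder:
  fixes f :: "real \<Rightarrow> 'a::real_normed_vector"
  assumes "d > 0"
    and "\<And>x. \<bar>x\<bar> < d \<Longrightarrow> norm (f x - f 0 - x *\<^sub>R v) \<le> C * x\<^sup>2"
  shows "(f has_vector_derivative v) (at 0)"
  unfolding has_vector_derivative_def
  by (rule has_derivative_if_quadratic_remainder[of _ d _ _ C])
     (use assms in \<open>auto intro: bounded_linear_scaleR_left\<close>)

text \<open>
  Boundedness of the terms at \<open>r / 2\<close> dominates the tail from the second order on by a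
  geometric series times \<open>x\<^sup>2\<close>.
\<close>
lemma power_series_has_vector_derivative_at_0:
  fixes c :: "nat \<Rightarrow> 'a::banach"
  assumes "r > 0" and sums: "\<And>x::real. \<bar>x\<bar> < r \<Longrightarrow> (\<lambda>n. x ^ n *\<^sub>R c n) sums f x"
  shows "(f has_vector_derivative c 1) (at 0)"
proof -
  define s where "s = r / 2"
  have s: "s > 0" "\<bar>s\<bar> < r" using assms(1) by (auto simp: s_def)
  have "Bseq (\<lambda>n. s ^ n *\<^sub>R c n)"
    using summable_LIMSEQ_zero[OF sums_summable[OF sums[OF s(2)]]]
    by (intro convergent_imp_Bseq convergentI)
  then obtain K where K: "K > 0" "\<And>n. norm (s ^ n *\<^sub>R c n) \<le> K"
    by (auto simp: Bseq_def)
  have f0: "f 0 = c 0"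
    using sums[of 0] assms(1) sums_finite[of "{0}" "\<lambda>n. 0 ^ n *\<^sub>R c n"] sums_unique2
    by auto
  show ?thesis
  proof (rule has_vector_derivative_if_quadratic_remainder[where d = "s / 2" and C = "2 * K / s\<^sup>2"])
    show "s / 2 > 0" using s by simp
    fix x :: real assume x: "\<bar>x\<bar> < s / 2"
    define q where "q = \<bar>x\<bar> / s"
    have q: "0 \<le> q" "q < 1/2" using x s by (auto simp: q_def field_simps)
    have "(\<lambda>n. x ^ n *\<^sub>R c n) sums f x" using x s by (intro sums) auto
    hence "(\<lambda>n. x ^ (n+2) *\<^sub>R c (n+2)) sums (f x - (\<Sum>n<2. x ^ n *\<^sub>R c n))"
      by (rule iffD2[OF sums_iff_shift'[where f = "\<lambda>n. x ^ n *\<^sub>R c n"]])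
    hence S: "(\<lambda>n. x ^ (n+2) *\<^sub>R c (n+2)) sums (f x - f 0 - x *\<^sub>R c 1)"
      by (simp add: f0 numeral_2_eq_2 diff_diff_eq)
    have bound: "norm (x ^ (n+2) *\<^sub>R c (n+2)) \<le> K * q\<^sup>2 * (1/2)^n" for n
    proof -
      have "norm (x ^ (n+2) *\<^sub>R c (n+2)) = q ^ (n+2) * norm (s ^ (n+2) *\<^sub>R c (n+2))"
        using s by (simp add: q_def power_abs[symmetric] power_divide abs_mult)
      also have "\<dots> \<le> q ^ (n+2) * K"
        using q by (intro mult_left_mono K(2)) auto
      also have "\<dots> = K * q\<^sup>2 * q ^ n"
        by (simp add: power_add power2_eq_square)
      also have "\<dots> \<le> K * q\<^sup>2 * (1/2) ^ n"
        using K q by (intro mult_left_mono power_mono) auto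
      finally show ?thesis .
    qed
    have G: "(\<lambda>n. K * q\<^sup>2 * (1/2)^n) sums (K * q\<^sup>2 * 2)"
      using sums_mult[OF geometric_sums[of "1/2::real"], of "K * q\<^sup>2"] by simp
    have "norm (f x - f 0 - x *\<^sub>R c 1) \<le> K * q\<^sup>2 * 2"
      by (rule norm_sums_le[OF S G bound])
    also have "\<dots> = 2 * K / s\<^sup>2 * x\<^sup>2" by (simp add: q_def power_divide)
    finally show "norm (f x - f 0 - x *\<^sub>R c 1) \<le> 2 * K / s\<^sup>2 * x\<^sup>2" .
  qed
qed

section \<open>Square matrices over the complex numbers\<close>

text \<open>
  The multiplication of the type of vectors is componentwise, so the tools for normed algebras do
  not apply to matrix products. Bilinearity in finite dimension supplies what is needed instead:
  continuity and a norm bound with some constant factor.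
\<close>
lemma bounded_bilinear_matrix_mult:
  "bounded_bilinear ((**) :: complex^'n^'m \<Rightarrow> complex^'p^'n \<Rightarrow> complex^'p^'m)"
  unfolding bilinear_conv_bounded_bilinear[symmetric] bilinear_def
  by (auto intro!: linearI simp: matrix_matrix_mult_def vec_eq_iff sum.distrib algebra_simps
      scaleR_sum_right)

lemma norm_matrix_mult_le:
  "\<exists>K>0. \<forall>(A :: complex^'n^'n) (B :: complex^'n^'n). norm (A ** B) \<le> norm A * norm B * K"
  by (rule bounded_bilinear.pos_bounded[OF bounded_bilinear_matrix_mult])

lemma mat_mult_nth [simp]: "(mat z ** A) $ i $ j = z * A $ i $ j"
  by (simp add: matrix_matrix_mult_def mat_def if_distrib[of "\<lambda>x. x * _"] sum.delta cong: if_cong)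

lemma mat_nth: "mat z $ i $ j = (if i = j then z else 0)"
  by (simp add: mat_def)

lemma has_vector_derivative_vec_componentwise:
  assumes "\<And>i. ((\<lambda>t. f t $ i) has_vector_derivative f' $ i) (at x)"
  shows "(f has_vector_derivative f') (at x)"
proof -
  have "bounded_linear (\<lambda>h::real. h *\<^sub>R f')" by (rule bounded_linear_scaleR_left)
  moreover have "((\<lambda>y. ((f y - f x) - (y - x) *\<^sub>R f') /\<^sub>R norm (y - x)) \<longlongrightarrow> 0) (at x)"
  proof (rule vec_tendstoI)
    fix i
    show "((\<lambda>y. (((f y - f x) - (y - x) *\<^sub>R f') /\<^sub>R norm (y - x)) $ i) \<longlongrightarrow> 0 $ i) (at x)"
      using assms[of i] unfolding has_vector_derivative_def has_derivative_at_within by simp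
  qed
  ultimately show ?thesis
    unfolding has_vector_derivative_def has_derivative_at_within by blast
qed

section \<open>The matrix exponential near a scalar matrix\<close>

lemma matrix_power_0 [simp]: "matrix_power M 0 = mat 1"
  and matrix_power_Suc [simp]: "matrix_power M (Suc n) = M ** matrix_power M n"
  by (simp_all add: matrix_power_def)

text \<open>
  A scalar matrix commutes with \<open>G\<close>, so \<open>(z + G)\<^sup>n = z\<^sup>n + n z\<^sup>n\<^sup>-\<^sup>1 G + R\<^sub>n\<close> with
  \<open>R\<^sub>n\<close> quadratic in \<open>G\<close>. The bound on \<open>R\<^sub>n\<close> grows only geometrically in \<open>n\<close>, so it
  survives the summation against \<open>1 / n!\<close>.
\<close>
lemma matrix_exp_quadratic_remainder_at_scalar:
  fixes z :: complex
  shows "\<exists>C. \<forall>G::complex^'n^'n. norm G \<le> 1 \<longrightarrow>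
    norm (matrix_exp (mat z + G) - mat (exp z) - mat (exp z) ** G) \<le> C * (norm G)\<^sup>2"
proof -
  interpret bil: bounded_bilinear "(**) :: complex^'n^'n \<Rightarrow> complex^'n^'n \<Rightarrow> complex^'n^'n"
    by (rule bounded_bilinear_matrix_mult)
  obtain K where K: "K > 0" "\<And>(A :: complex^'n^'n) (B :: complex^'n^'n). norm (A ** B) \<le> norm A * norm B * K"
    using norm_matrix_mult_le[where 'n = 'n] by auto
  define L where "L = K * norm (mat z :: complex^'n^'n) + K + norm z + 1"
  have L: "L \<ge> 1" "norm z \<le> L" 
    using mult_nonneg_nonneg[OF less_imp_le[OF K(1)] norm_ge_zero[of "mat z :: complex^'n^'n"]]
      K(1) norm_ge_zero[of z] unfolding L_def by linarith+
  define C where "C = exp (2 * L) * K"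
  have main: "norm (matrix_exp (mat z + G) - mat (exp z) - mat (exp z) ** G) \<le> C * (norm G)\<^sup>2"
    if G: "norm G \<le> 1" for G :: "complex^'n^'n"
  proof -
    define N where "N = mat z + G"
    define R where "R n = matrix_power N n - mat (z ^ n) - mat (of_nat n * z ^ (n - 1)) ** G" for n
    have N: "K * norm N \<le> L"
    proof -
      have "norm N \<le> norm (mat z :: complex^'n^'n) + 1"
        unfolding N_def using G norm_triangle_ineq[of "mat z" G] by linarith
      from mult_left_mono[OF this less_imp_le[OF K(1)]] show ?thesis using norm_ge_zero[of z]
        unfolding L_def distrib_left by linarith
    qed
    have scal: "mat w ** (A ** B) = A ** (mat w ** B)" for w and A :: "complex^'n^'n" and B :: "complex^'n^'n"
      by (simp add: vec_eq_iff matrix_matrix_mult_def[of A] sum_distrib_left mult.left_commute)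
    have zG: "norm (mat w ** A) = norm w * norm A" for w and A :: "complex^'n^'n"
      by (simp add: norm_vec_def norm_mult L2_set_right_distrib)
    \<comment> \<open>Inductive form of the remainder; the inhomogeneity is where the square of \<open>G\<close> comes from.\<close>
    have RSuc: "R (Suc n) = N ** R n + mat (of_nat n * z ^ (n - 1)) ** (G ** G)" for n
    proof -
      have comm: "N ** mat w = mat w ** N" for w using scal[of w N "mat 1"] by simp
      have NG: "N ** G = mat z ** G + G ** G" by (simp add: N_def bil.add_left)
      have "N ** R n = N ** matrix_power N n - mat (z ^ n) ** N - mat (of_nat n * z ^ (n - 1)) ** (mat z ** G + G ** G)"
        by (simp only: R_def bil.diff_right comm scal[symmetric] NG)
      moreover have "mat (z ^ n) ** N + mat (of_nat n * z ^ (n - 1)) ** (mat z ** G)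
          = mat (z ^ Suc n) + mat (of_nat (Suc n) * z ^ n) ** G"
        by (cases n) (simp_all add: vec_eq_iff N_def mat_nth algebra_simps)
      moreover have "R (Suc n) = N ** matrix_power N n - (mat (z ^ Suc n) + mat (of_nat (Suc n) * z ^ n) ** G)"
        by (simp add: R_def)
      ultimately show ?thesis
        by (simp only: bil.add_right) (simp add: algebra_simps)
    qed
    \<comment> \<open>Both terms of the recursion are at most \<open>L (2 L)\<^sup>n g\<close> with \<open>g = K (norm G)\<^sup>2\<close>; the factor 2 in the base leaves room
       for their sum and absorbs the factor \<open>n\<close> of the second term through \<open>n \<le> 2\<^sup>n\<close>.\<close>
    have R: "norm (R n) \<le> (2 * L) ^ n * (K * (norm G)\<^sup>2)" for n
    proof (induction n)
      case 0 thus ?case using K by (simp add: R_def vec_eq_iff)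
    next
      case (Suc n)
      define g where "g = K * (norm G)\<^sup>2"
      have g: "g \<ge> 0" using K by (simp add: g_def)
      have 1: "norm (N ** R n) \<le> L * ((2 * L) ^ n * g)"
      proof -
        have "norm (N ** R n) \<le> (K * norm N) * norm (R n)" using K(2)[of N "R n"] by (simp add: ac_simps)
        also have "\<dots> \<le> L * ((2 * L) ^ n * g)"
          using N Suc L(1) unfolding g_def by (intro mult_mono) auto
        finally show ?thesis .
      qed
      have 2: "norm (mat (of_nat n * z ^ (n - 1)) ** (G ** G)) \<le> L * ((2 * L) ^ n * g)"
      proof -
        have a: "real n \<le> 2 ^ n" using of_nat_less_two_power[of n, where ?'a = real] by linarith
        have b: "norm z ^ (n - 1) \<le> L ^ n"
        proof -
          have "norm z ^ (n - 1) \<le> L ^ (n - 1)" using L by (intro power_mono) auto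
          also have "\<dots> \<le> L ^ n" using L by (intro power_increasing) auto
          finally show ?thesis .
        qed
        have "norm (mat (of_nat n * z ^ (n - 1)) ** (G ** G)) = (real n * norm z ^ (n - 1)) * norm (G ** G)"
          by (simp add: zG norm_mult norm_power)
        also have "\<dots> \<le> (2 ^ n * L ^ n) * g"
          using a b L(1) K(2)[of G G]
          by (intro mult_mono) (simp_all add: g_def power2_eq_square mult.commute)
        also have "\<dots> \<le> L * (2 ^ n * L ^ n * g)" 
          using mult_right_mono[OF L(1), of "2 ^ n * L ^ n * g"] L g by simp
        finally show ?thesis by (simp add: power_mult_distrib)
      qed
      have "norm (R (Suc n)) \<le> L * ((2 * L) ^ n * g) + L * ((2 * L) ^ n * g)"
        unfolding RSuc by (rule norm_triangle_le[OF add_mono[OF 1 2]])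
      thus ?case unfolding g_def by (simp add: ac_simps)
    qed
    have E: "(\<lambda>n. (2 * L) ^ n /\<^sub>R fact n * (K * (norm G)\<^sup>2)) sums (exp (2 * L) * (K * (norm G)\<^sup>2))"
      by (intro sums_mult2 exp_converges)
    have bound: "norm (R n /\<^sub>R fact n) \<le> (2 * L) ^ n /\<^sub>R fact n * (K * (norm G)\<^sup>2)" for n
      using mult_left_mono[OF R[of n], of "inverse (fact n)"] by (simp add: ac_simps)
    have sR: "summable (\<lambda>n. R n /\<^sub>R fact n)"
      by (rule summable_comparison_test'[OF sums_summable[OF E], of 0]) (use bound in auto)
    have D: "(\<lambda>n. (of_nat n * z ^ (n - 1)) /\<^sub>R fact n) sums exp z"
    proof -
      have shift: "(of_nat (Suc n) * z ^ (Suc n - 1)) /\<^sub>R fact (Suc n) = z ^ n /\<^sub>R fact n" for n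
      proof -
        have "inverse (fact (Suc n)) * real (Suc n) = inverse (fact n :: real)"
          by (simp add: field_simps del: of_nat_Suc)
        moreover have "of_nat (Suc n) * z ^ (Suc n - 1) = real (Suc n) *\<^sub>R z ^ n"
          by (simp add: scaleR_conv_of_real del: of_nat_Suc)
        ultimately show ?thesis by (simp only: scaleR_scaleR)
      qed
      have "(\<lambda>n. (of_nat (Suc n) * z ^ (Suc n - 1)) /\<^sub>R fact (Suc n)) sums exp z"
        unfolding shift by (rule exp_converges)
      thus ?thesis by (rule sums_Suc_imp[rotated]) simp
    qed
    have lin: "bounded_linear (\<lambda>w. mat w ** A)" for A :: "complex^'n^'n"
      unfolding linear_conv_bounded_linear[symmetric]
      by (intro linearI) (simp_all add: vec_eq_iff algebra_simps)
    have "(\<lambda>n. mat (z ^ n /\<^sub>R fact n) ** mat 1 + mat ((of_nat n * z ^ (n - 1)) /\<^sub>R fact n) ** G + R n /\<^sub>R fact n)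
       sums (mat (exp z) ** mat 1 + mat (exp z) ** G + (\<Sum>n. R n /\<^sub>R fact n))"
      by (rule sums_add[OF sums_add[OF bounded_linear.sums[OF lin exp_converges] bounded_linear.sums[OF lin D]] summable_sums[OF sR]])
    moreover have "mat (z ^ n /\<^sub>R fact n) ** mat 1 + mat ((of_nat n * z ^ (n - 1)) /\<^sub>R fact n) ** G + R n /\<^sub>R fact n
       = (1 / fact n) *\<^sub>R matrix_power N n" for n
    proof -
      have "matrix_power N n = mat (z ^ n) ** mat 1 + mat (of_nat n * z ^ (n - 1)) ** G + R n"
        by (simp add: R_def)
      thus ?thesis
        by (simp only: linear_scale[OF bounded_linear.linear[OF lin]] scaleR_add_right inverse_eq_divide)
    qed
    ultimately have "matrix_exp N = mat (exp z) ** mat 1 + mat (exp z) ** G + (\<Sum>n. R n /\<^sub>R fact n)"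
      unfolding matrix_exp_def by (simp add: sums_iff)
    hence "matrix_exp N - mat (exp z) - mat (exp z) ** G = (\<Sum>n. R n /\<^sub>R fact n)" by simp
    also have "norm \<dots> \<le> exp (2 * L) * (K * (norm G)\<^sup>2)"
      by (rule norm_sums_le[OF summable_sums[OF sR] E bound])
    finally show ?thesis by (simp add: N_def C_def)
  qed
  thus ?thesis by blast
qed

lemma has_vector_derivative_matrix_exp_at_scalar:
  fixes H :: "real \<Rightarrow> complex^'n^'n"
  assumes H: "(H has_vector_derivative H') (at x)" and Hx: "H x = mat z"
  shows "((\<lambda>x. matrix_exp (H x)) has_vector_derivative mat (exp z) ** H') (at x)"
proof -
  interpret bil: bounded_bilinear "(**) :: complex^'n^'n \<Rightarrow> complex^'n^'n \<Rightarrow> complex^'n^'n"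
    by (rule bounded_bilinear_matrix_mult)
  obtain C where C: "\<And>G::complex^'n^'n. norm G \<le> 1 \<Longrightarrow>
      norm (matrix_exp (mat z + G) - mat (exp z) - mat (exp z) ** G) \<le> C * (norm G)\<^sup>2"
    using matrix_exp_quadratic_remainder_at_scalar[of z, where 'n = 'n] by auto
  have at_scalar: "matrix_exp (mat z :: complex^'n^'n) = mat (exp z)"
    using C[of 0] by (simp add: bil.zero_right)
  have "(matrix_exp has_derivative (**) (mat (exp z))) (at (mat z :: complex^'n^'n))"
    by (rule has_derivative_if_quadratic_remainder[of _ 1 _ _ C])
       (use C in \<open>auto simp: at_scalar bil.bounded_linear_right\<close>)
  from has_derivative_compose[OF H[unfolded has_vector_derivative_def] this[folded Hx]]
  show ?thesis
    by (simp add: has_vector_derivative_def bil.scaleR_right)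
qed

section \<open>First order perturbation of the monodromy matrix\<close>

text \<open>
  Integrating the equation gives \<open>Y \<epsilon> t = 1 + \<epsilon> \<integral> B Y\<close>. For small \<open>\<epsilon>\<close> this forces the
  maximum of \<open>Y \<epsilon>\<close> on the interval to be at most twice the norm of the identity, hence
  \<open>Y \<epsilon> - 1 = O(\<epsilon>)\<close>, hence replacing \<open>Y \<epsilon>\<close> by \<open>1\<close> under the integral costs \<open>O(\<epsilon>\<^sup>2)\<close>.
\<close>
lemma first_order_perturbation:
  fixes B :: "real \<Rightarrow> complex^'n^'n" and Y :: "real \<Rightarrow> real \<Rightarrow> complex^'n^'n"
  assumes "r > 0" and T: "T > 0" and cont: "continuous_on {0..T} B"
    and Y0: "\<And>\<epsilon>. \<bar>\<epsilon>\<bar> < r \<Longrightarrow> Y \<epsilon> 0 = mat 1"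
    and ode: "\<And>\<epsilon> t. \<bar>\<epsilon>\<bar> < r \<Longrightarrow> (Y \<epsilon> has_vector_derivative \<epsilon> *\<^sub>R (B t ** Y \<epsilon> t)) (at t)"
  shows "((\<lambda>\<epsilon>. Y \<epsilon> T) has_vector_derivative integral {0..T} B) (at 0)"
proof -
  interpret bil: bounded_bilinear "(**) :: complex^'n^'n \<Rightarrow> complex^'n^'n \<Rightarrow> complex^'n^'n"
    by (rule bounded_bilinear_matrix_mult)
  obtain K where K: "K > 0" "\<And>(A :: complex^'n^'n) (B :: complex^'n^'n). norm (A ** B) \<le> norm A * norm B * K"
    using norm_matrix_mult_le[where 'n = 'n] by auto
  have "bounded (B ` {0..T})"
    by (intro compact_imp_bounded compact_continuous_image cont compact_Icc)
  then obtain b where b: "b > 0" "\<And>t. t \<in> {0..T} \<Longrightarrow> norm (B t) \<le> b"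
    by (auto simp: bounded_pos)
  define I where "I = (mat 1 :: complex^'n^'n)"
  define q where "q = b * K * T"
  have q: "q > 0" using b K T by (simp add: q_def)
  \<comment> \<open>Below this threshold the integral operator \<open>Y \<mapsto> \<epsilon> \<integral> B Y\<close> has norm at most \<open>1 / 2\<close>.\<close>
  define d where "d = min r (1 / (2 * q))"
  have "d > 0" using assms(1) q by (simp add: d_def)
  have estimates: "norm (Y \<epsilon> T - I) \<le> \<bar>\<epsilon>\<bar> * (2 * norm I * q)"
    "norm (Y \<epsilon> T - I - \<epsilon> *\<^sub>R integral {0..T} B) \<le> (2 * norm I * q\<^sup>2) * \<epsilon>\<^sup>2"
    if eps: "\<bar>\<epsilon>\<bar> < d" for \<epsilon>
  proof -
    have er: "\<bar>\<epsilon>\<bar> < r" and eq: "\<bar>\<epsilon>\<bar> * q \<le> 1 / 2" 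
      using eps q by (auto simp: d_def field_simps)
    have contY: "continuous_on S (Y \<epsilon>)" for S
      by (intro continuous_at_imp_continuous_on ballI has_vector_derivative_continuous[OF ode[OF er]])
    have duhamel: "((\<lambda>s. \<epsilon> *\<^sub>R (B s ** Y \<epsilon> s)) has_integral Y \<epsilon> t - I) {0..t}" if "t \<in> {0..T}" for t
      using fundamental_theorem_of_calculus[of 0 t "Y \<epsilon>" "\<lambda>s. \<epsilon> *\<^sub>R (B s ** Y \<epsilon> s)"] that 
        has_vector_derivative_at_within[OF ode[OF er]] by (simp add: I_def Y0[OF er])
    have bnd: "norm (Y \<epsilon> t - I) \<le> \<bar>\<epsilon>\<bar> * (M * q)"
      if "t \<in> {0..T}" and M: "\<And>s. s \<in> {0..T} \<Longrightarrow> norm (Y \<epsilon> s) \<le> M" for t M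
    proof -
      have M0: "M \<ge> 0" using order_trans[OF norm_ge_zero M[of 0]] T by simp
      have "norm (Y \<epsilon> t - I) \<le> (\<bar>\<epsilon>\<bar> * (b * M * K)) * measure lborel (cbox 0 t)"
      proof (rule has_integral_bound)
        show "((\<lambda>s. \<epsilon> *\<^sub>R (B s ** Y \<epsilon> s)) has_integral Y \<epsilon> t - I) (cbox 0 t)"
          using duhamel[OF that(1)] by simp
        show "0 \<le> \<bar>\<epsilon>\<bar> * (b * M * K)" using b K M0 by simp
        fix s assume "s \<in> cbox 0 t"
        hence s: "s \<in> {0..T}" using that(1) by auto
        have "norm (B s ** Y \<epsilon> s) \<le> b * M * K"
          using K(2)[of "B s" "Y \<epsilon> s"] mult_mono[OF b(2)[OF s] M[OF s]] b(1) K(1)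
          by (smt (verit) mult_right_mono norm_ge_zero)
        thus "norm (\<epsilon> *\<^sub>R (B s ** Y \<epsilon> s)) \<le> \<bar>\<epsilon>\<bar> * (b * M * K)"
          by (simp add: mult_left_mono)
      qed
      also have "\<dots> \<le> (\<bar>\<epsilon>\<bar> * (b * M * K)) * T"
        using that(1) b K M0 by (intro mult_left_mono) auto
      finally show ?thesis by (simp add: q_def ac_simps)
    qed
    \<comment> \<open>A priori bound: apply the integral estimate where the norm of \<open>Y \<epsilon>\<close> is largest.\<close>
    have "\<exists>t0\<in>{0..T}. \<forall>s\<in>{0..T}. norm (Y \<epsilon> s) \<le> norm (Y \<epsilon> t0)"
      using T by (intro continuous_attains_sup continuous_intros contY) auto
    then obtain t0 where t0: "t0 \<in> {0..T}" "\<And>s. s \<in> {0..T} \<Longrightarrow> norm (Y \<epsilon> s) \<le> norm (Y \<epsilon> t0)"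
      by blast
    have "norm (Y \<epsilon> t0) \<le> norm I + norm (Y \<epsilon> t0 - I)" 
      using norm_triangle_ineq[of I "Y \<epsilon> t0 - I"] by simp
    also have "\<dots> \<le> norm I + norm (Y \<epsilon> t0) * (\<bar>\<epsilon>\<bar> * q)"
      using bnd[OF t0] by (simp add: ac_simps)
    also have "\<dots> \<le> norm I + norm (Y \<epsilon> t0) * (1 / 2)"
      using eq by (intro add_left_mono mult_left_mono) auto
    finally have "norm (Y \<epsilon> t0) \<le> 2 * norm I" by simp
    hence M: "norm (Y \<epsilon> s) \<le> 2 * norm I" if "s \<in> {0..T}" for s
      using t0(2)[OF that] by simp
    have close: "norm (Y \<epsilon> t - I) \<le> \<bar>\<epsilon>\<bar> * (2 * norm I * q)" if "t \<in> {0..T}" for t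
      using bnd[OF that M] by simp
    from close[of T] T show "norm (Y \<epsilon> T - I) \<le> \<bar>\<epsilon>\<bar> * (2 * norm I * q)" by simp
    have "((\<lambda>s. \<epsilon> *\<^sub>R (B s ** Y \<epsilon> s) - \<epsilon> *\<^sub>R B s) has_integral 
            (Y \<epsilon> T - I - \<epsilon> *\<^sub>R integral {0..T} B)) {0..T}"
      using T by (intro has_integral_diff duhamel has_integral_cmul integrable_integral 
          integrable_continuous_interval cont) auto
    hence "((\<lambda>s. \<epsilon> *\<^sub>R (B s ** (Y \<epsilon> s - I))) has_integral 
            (Y \<epsilon> T - I - \<epsilon> *\<^sub>R integral {0..T} B)) (cbox 0 T)"
      by (simp add: bil.diff_right I_def scaleR_diff_right)
    hence "norm (Y \<epsilon> T - I - \<epsilon> *\<^sub>R integral {0..T} B) 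
        \<le> (\<bar>\<epsilon>\<bar> * (b * (\<bar>\<epsilon>\<bar> * (2 * norm I * q)) * K)) * measure lborel (cbox 0 T)"
    proof (rule has_integral_bound[rotated])
      show "0 \<le> \<bar>\<epsilon>\<bar> * (b * (\<bar>\<epsilon>\<bar> * (2 * norm I * q)) * K)" using b K q by simp
      fix s assume "s \<in> cbox 0 T"
      hence s: "s \<in> {0..T}" by simp
      have "norm (B s ** (Y \<epsilon> s - I)) \<le> b * (\<bar>\<epsilon>\<bar> * (2 * norm I * q)) * K"
        using K(2)[of "B s" "Y \<epsilon> s - I"] mult_mono[OF b(2)[OF s] close[OF s]] b(1) K(1)
        by (smt (verit) mult_right_mono norm_ge_zero)
      thus "norm (\<epsilon> *\<^sub>R (B s ** (Y \<epsilon> s - I))) \<le> \<bar>\<epsilon>\<bar> * (b * (\<bar>\<epsilon>\<bar> * (2 * norm I * q)) * K)"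
        by (simp add: mult_left_mono)
    qed
    also have "\<dots> = (2 * norm I * q\<^sup>2) * \<epsilon>\<^sup>2" 
      using T by (simp add: q_def power2_eq_square)
    finally show "norm (Y \<epsilon> T - I - \<epsilon> *\<^sub>R integral {0..T} B) \<le> (2 * norm I * q\<^sup>2) * \<epsilon>\<^sup>2" .
  qed
  have "Y 0 T = I" using estimates(1)[of 0] \<open>d > 0\<close> by simp
  with estimates(2) show ?thesis
    by (intro has_vector_derivative_if_quadratic_remainder[OF \<open>d > 0\<close>]) auto
qed

text \<open>
  Factoring out the unperturbed flow \<open>exp (A\<^sub>0 t)\<close> leaves an equation whose right-hand side is of
  order \<open>\<epsilon>\<close>. As \<open>A\<^sub>0\<close> is diagonal, the flow acts entrywise by scalar exponentials.
\<close>
lemma interaction_picture: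
  fixes A\<^sub>0 :: "complex^'n^'n" and A\<^sub>1 X :: "real \<Rightarrow> complex^'n^'n"
  defines "Y \<equiv> \<lambda>t. \<chi> i j. exp (- A\<^sub>0 $ i $ i * of_real t) * X t $ i $ j"
    and "B \<equiv> \<lambda>t. \<chi> i j. exp ((A\<^sub>0 $ j $ j - A\<^sub>0 $ i $ i) * of_real t) * A\<^sub>1 t $ i $ j"
  assumes diag: "diagonal_matrix A\<^sub>0" 
    and X: "fundamental_solution (\<lambda>t. A\<^sub>0 + \<epsilon> *\<^sub>R A\<^sub>1 t) X"
  shows "Y 0 = mat 1" and "(Y has_vector_derivative \<epsilon> *\<^sub>R (B t ** Y t)) (at t)"
proof -
  show "Y 0 = mat 1"
    using X by (simp add: Y_def fundamental_solution_def vec_eq_iff)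
  show "(Y has_vector_derivative \<epsilon> *\<^sub>R (B t ** Y t)) (at t)"
  proof (rule has_vector_derivative_vec_componentwise, rule has_vector_derivative_vec_componentwise)
    fix i j
    define S where "S = (\<Sum>k\<in>UNIV. A\<^sub>1 t $ i $ k * X t $ k $ j)"
    define l where "l = A\<^sub>0 $ i $ i"
    have "(\<Sum>k\<in>UNIV. A\<^sub>0 $ i $ k * X t $ k $ j) = (\<Sum>k\<in>{i}. A\<^sub>0 $ i $ k * X t $ k $ j)"
      using diag by (intro sum.mono_neutral_right) (auto simp: diagonal_matrix_def)
    hence comp: "((A\<^sub>0 + \<epsilon> *\<^sub>R A\<^sub>1 t) ** X t) $ i $ j = l * X t $ i $ j + \<epsilon> *\<^sub>R S"
      by (simp add: matrix_matrix_mult_def distrib_right sum.distrib S_def l_def scaleR_sum_right)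
    have "(X has_vector_derivative ((A\<^sub>0 + \<epsilon> *\<^sub>R A\<^sub>1 t) ** X t)) (at t)"
      using X by (simp add: fundamental_solution_def)
    hence dX: "((\<lambda>t. X t $ i $ j) has_vector_derivative (l * X t $ i $ j + \<epsilon> *\<^sub>R S)) (at t)"
      unfolding comp[symmetric]
      by (intro bounded_linear.has_vector_derivative[OF bounded_linear_vec_nth])
    have dE: "((\<lambda>t. exp (- l * of_real t)) has_vector_derivative - l * exp (- l * of_real t)) (at t)"
      by (rule has_vector_derivative_real_field) (auto intro!: derivative_eq_intros)
    have "((\<lambda>t. exp (- l * of_real t) * X t $ i $ j) has_vector_derivative
        exp (- l * of_real t) * (l * X t $ i $ j + \<epsilon> *\<^sub>R S) + (- l * exp (- l * of_real t)) * X t $ i $ j) (at t)"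
      by (rule has_vector_derivative_mult[OF dE dX])
    also have "exp (- l * of_real t) * (l * X t $ i $ j + \<epsilon> *\<^sub>R S) + (- l * exp (- l * of_real t)) * X t $ i $ j
        = \<epsilon> *\<^sub>R (exp (- l * of_real t) * S)" by (simp add: algebra_simps)
    also have "exp (- l * of_real t) * S = (B t ** Y t) $ i $ j"
    proof -
      have "exp ((A\<^sub>0 $ k $ k - l) * of_real t) * exp (- A\<^sub>0 $ k $ k * of_real t) = exp (- l * of_real t)" for k
        by (simp add: exp_add[symmetric] algebra_simps)
      hence cancel: "exp ((A\<^sub>0 $ k $ k - l) * of_real t) * a * (exp (- A\<^sub>0 $ k $ k * of_real t) * x) 
          = exp (- l * of_real t) * (a * x)" for k a x
        by (metis (no_types, lifting) mult.assoc mult.left_commute)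
      have "(B t ** Y t) $ i $ j = (\<Sum>k\<in>UNIV. exp ((A\<^sub>0 $ k $ k - l) * of_real t) * A\<^sub>1 t $ i $ k *
          (exp (- A\<^sub>0 $ k $ k * of_real t) * X t $ k $ j))"
        by (simp only: matrix_matrix_mult_def B_def Y_def vec_lambda_beta l_def)
      thus ?thesis by (simp only: cancel S_def sum_distrib_left)
    qed
    finally show "((\<lambda>t. Y t $ i $ j) has_vector_derivative (\<epsilon> *\<^sub>R (B t ** Y t)) $ i $ j) (at t)"
      by (simp add: Y_def l_def)
  qed
qed

text \<open>
  At time \<open>T\<close> the periodic factor is the identity, so the solution equals \<open>exp (T F\<^sub>\<epsilon>)\<close>; the
  two sides of the formula are its derivatives at \<open>\<epsilon> = 0\<close>, after removal of the common factor
  \<open>exp (T f)\<close>. The hypothesis \<open>F\<^sub>0 = f I\<close> makes the exponential differentiable by a plain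
  product formula; for distinct diagonal entries the off-diagonal derivative would be different.
\<close>
theorem first_order_floquet_exponent:
  fixes A\<^sub>0 :: "complex^'n^'n" and A\<^sub>1 :: "real \<Rightarrow> complex^'n^'n"
  assumes expansion: "floquet_exponent_expansion T A\<^sub>0 A\<^sub>1 Fc" and T: "T > 0"
    and diag: "diagonal_matrix A\<^sub>0" and cont: "continuous_on {0..T} A\<^sub>1" 
    and scalar: "Fc 0 = mat f"
  shows "((\<lambda>t. exp ((A\<^sub>0 $ j $ j - A\<^sub>0 $ i $ i) * of_real t) * A\<^sub>1 t $ i $ j)
           has_integral T *\<^sub>R Fc 1 $ i $ j) {0..T}"
proof -
  interpret bil: bounded_bilinear "(**) :: complex^'n^'n \<Rightarrow> complex^'n^'n \<Rightarrow> complex^'n^'n"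
    by (rule bounded_bilinear_matrix_mult)
  obtain F P r where r: "r > 0"
    and F: "\<And>\<epsilon>::real. \<bar>\<epsilon>\<bar> < r \<Longrightarrow> (\<lambda>n. \<epsilon> ^ n *\<^sub>R Fc n) sums F \<epsilon>"
    and period: "\<And>\<epsilon> t. \<bar>\<epsilon>\<bar> < r \<Longrightarrow> P \<epsilon> (t + T) = P \<epsilon> t"
    and P0: "\<And>\<epsilon>. \<bar>\<epsilon>\<bar> < r \<Longrightarrow> P \<epsilon> 0 = mat 1"
    and X: "\<And>\<epsilon>. \<bar>\<epsilon>\<bar> < r \<Longrightarrow> fundamental_solution (\<lambda>t. A\<^sub>0 + \<epsilon> *\<^sub>R A\<^sub>1 t)
             (\<lambda>t. P \<epsilon> t ** matrix_exp (t *\<^sub>R F \<epsilon>))"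
  proof -
    from expansion show thesis
      unfolding floquet_exponent_expansion_def
      apply (elim conjE exE)
      subgoal for F P Pc r by (rule that[of r F P]) simp_all
      done
  qed
  define X where "X \<epsilon> t = P \<epsilon> t ** matrix_exp (t *\<^sub>R F \<epsilon>)" for \<epsilon> t
  define Y where "Y \<epsilon> t = (\<chi> i j. exp (- A\<^sub>0 $ i $ i * of_real t) * X \<epsilon> t $ i $ j)" for \<epsilon> t
  define B where "B t = (\<chi> i j. exp ((A\<^sub>0 $ j $ j - A\<^sub>0 $ i $ i) * of_real t) * A\<^sub>1 t $ i $ j)" for t
  have contB: "continuous_on {0..T} B"
    unfolding B_def by (intro continuous_intros cont)
  have dY: "((\<lambda>\<epsilon>. Y \<epsilon> T) has_vector_derivative integral {0..T} B) (at 0)"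
    using interaction_picture[OF diag X, folded X_def Y_def B_def]
    by (intro first_order_perturbation[OF r T contB]) (auto simp: Y_def)
  have F0: "F 0 = mat f"
    using F[of 0] r sums_finite[of "{0}" "\<lambda>n. 0 ^ n *\<^sub>R Fc n"] sums_unique2 scalar by auto
  have "((\<lambda>\<epsilon>. T *\<^sub>R F \<epsilon>) has_vector_derivative T *\<^sub>R Fc 1) (at 0)"
    by (intro bounded_linear.has_vector_derivative[OF bounded_linear_scaleR_right]
        power_series_has_vector_derivative_at_0[OF r F])
  moreover have "T *\<^sub>R F 0 = mat (of_real T * f)"
    by (simp add: F0 vec_eq_iff mat_nth) (simp add: scaleR_conv_of_real)
  ultimately have "((\<lambda>\<epsilon>. matrix_exp (T *\<^sub>R F \<epsilon>)) has_vector_derivative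
      mat (exp (of_real T * f)) ** (T *\<^sub>R Fc 1)) (at 0)"
    by (rule has_vector_derivative_matrix_exp_at_scalar)
  hence "((\<lambda>\<epsilon>. mat (exp (- (of_real T * f))) ** matrix_exp (T *\<^sub>R F \<epsilon>)) has_vector_derivative
      mat (exp (- (of_real T * f))) ** (mat (exp (of_real T * f)) ** (T *\<^sub>R Fc 1))) (at 0)"
    by (rule bounded_linear.has_vector_derivative[OF bil.bounded_linear_right])
  also have "mat (exp (- (of_real T * f))) ** (mat (exp (of_real T * f)) ** (T *\<^sub>R Fc 1)) = T *\<^sub>R Fc 1"
    by (simp add: vec_eq_iff mult.assoc[symmetric] exp_add[symmetric])
  finally have dM: "((\<lambda>\<epsilon>. mat (exp (- (of_real T * f))) ** matrix_exp (T *\<^sub>R F \<epsilon>)) 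
      has_vector_derivative T *\<^sub>R Fc 1) (at 0)" .
  \<comment> \<open>Folding changes the exponents by multiples of \<open>2 \<pi> \<i> / T\<close>, which is invisible at time \<open>T\<close>.\<close>
  have multiplier: "exp (- A\<^sub>0 $ i $ i * of_real T) = exp (- (of_real T * f))" for i
  proof -
    obtain m :: int where "A\<^sub>0 $ i $ i - f = 2 * of_real pi * \<i> / of_real T * of_int m"
      using expansion unfolding floquet_exponent_expansion_def folding_def
      by (metis scalar mat_nth)
    hence "- A\<^sub>0 $ i $ i * of_real T = - (of_real T * f) + of_real (of_int (2 * (- m)) * pi) * \<i>"
      using T by (simp add: field_simps)
    thus ?thesis by (simp only: exp_eq) blast
  qed
  have YM: "Y \<epsilon> T = mat (exp (- (of_real T * f))) ** matrix_exp (T *\<^sub>R F \<epsilon>)" if "\<bar>\<epsilon>\<bar> < r" for \<epsilon>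
  proof -
    have "X \<epsilon> T = matrix_exp (T *\<^sub>R F \<epsilon>)"
      using period[OF that, of 0] P0[OF that] by (simp add: X_def)
    thus ?thesis using multiplier by (simp add: Y_def vec_eq_iff)
  qed
  have "((\<lambda>\<epsilon>. Y \<epsilon> T) has_vector_derivative T *\<^sub>R Fc 1) (at 0)"
    by (rule has_vector_derivative_transform_within_open[OF dM, where S = "{-r<..<r}"])
       (use r YM in auto)
  from vector_derivative_unique_at[OF dY this] have "integral {0..T} B = T *\<^sub>R Fc 1" .
  hence "(B has_integral T *\<^sub>R Fc 1) {0..T}"
    using integrable_integral[OF integrable_continuous_interval[OF contB]] by simp
  hence "((\<lambda>t. B t $ i $ j) has_integral (T *\<^sub>R Fc 1) $ i $ j) {0..T}"
    using has_integral_linear[OF has_integral_linear[OF _ bounded_linear_vec_nth[of i]]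
        bounded_linear_vec_nth[of j], of B "T *\<^sub>R Fc 1" "{0..T}"] by (simp add: o_def)
  thus ?thesis by (simp add: B_def)
qed

section \<open>Diagonalizability in dimension two\<close>

lemma diagonalizable_if_eigenbasis:
  fixes M S D :: "complex^'n^'n"
  assumes "invertible S" and "diagonal_matrix D" and "M ** S = S ** D"
  shows "diagonalizable M"
proof -
  have "S ** matrix_inv S = mat 1"
    using assms(1) unfolding invertible_def matrix_inv_def by (metis (mono_tags, lifting) someI_ex)
  hence "M = S ** D ** matrix_inv S"
    unfolding assms(3)[symmetric] by (simp add: matrix_mul_assoc[symmetric])
  thus ?thesis using assms(1,2) unfolding diagonalizable_def
    by (intro exI[of _ S] exI[of _ D] conjI)
qed

lemma diagonalizable_if_diagonal:
  "diagonal_matrix M \<Longrightarrow> diagonalizable M"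
  by (rule diagonalizable_if_eigenbasis[of "mat 1"])
     (auto simp: invertible_def intro: exI[of _ "mat 1"])

text \<open>
  The expression is the discriminant of the characteristic polynomial, so the two eigenvalues are
  distinct.
\<close>
lemma diagonalizable_if_discriminant_nonzero:
  fixes M :: "complex^2^2"
  assumes "(M $ 1 $ 1 - M $ 2 $ 2)\<^sup>2 + 4 * M $ 1 $ 2 * M $ 2 $ 1 \<noteq> 0"
  shows "diagonalizable M"
proof -
  define p q r s where pqrs: "p = M $ 1 $ 1" "q = M $ 1 $ 2" "r = M $ 2 $ 1" "s = M $ 2 $ 2"
  define \<delta> where "\<delta> = csqrt ((p - s)\<^sup>2 + 4 * q * r)"
  have \<delta>: "\<delta>\<^sup>2 = (p - s)\<^sup>2 + 4 * q * r" "\<delta> \<noteq> 0" using assms by (auto simp: \<delta>_def pqrs)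
  show ?thesis
  proof (cases "q = 0")
    case False
    define \<mu> \<nu> where \<mu>\<nu>: "\<mu> = (p + s + \<delta>) / 2" "\<nu> = (p + s - \<delta>) / 2"
    have rq: "r * q = (\<delta>\<^sup>2 - (p - s)\<^sup>2) / 4" using \<delta>(1) by simp
    have char: "r * q + s * (\<mu> - p) = (\<mu> - p) * \<mu>" "r * q + s * (\<nu> - p) = (\<nu> - p) * \<nu>"
      unfolding rq by (simp_all add: \<mu>\<nu> field_simps power2_eq_square)
    \<comment> \<open>Columns: the eigenvectors \<open>(q, \<mu> - p)\<close> and \<open>(q, \<nu> - p)\<close>.\<close>
    define S D :: "complex^2^2"
      where SD: "S = vector [vector [q, q], vector [\<mu> - p, \<nu> - p]]"
        "D = vector [vector [\<mu>, 0], vector [0, \<nu>]]"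
    show ?thesis
    proof (rule diagonalizable_if_eigenbasis[of S D])
      show "invertible S"
        using False \<delta>(2) by (simp add: SD invertible_det_nz det_2 \<mu>\<nu> field_simps)
      show "M ** S = S ** D"
        using char by (simp add: SD vec_eq_iff forall_2 matrix_matrix_mult_def sum_2 flip: pqrs)
          (simp add: algebra_simps)
    qed (simp add: SD diagonal_matrix_def forall_2)
  next
    case True
    hence ps: "p \<noteq> s" using \<delta> by auto
    \<comment> \<open>Lower triangular case: for \<open>q = 0\<close> the columns used above are linearly dependent.\<close>
    define S D :: "complex^2^2"
      where SD: "S = vector [vector [p - s, 0], vector [r, 1]]"
        "D = vector [vector [p, 0], vector [0, s]]"
    show ?thesis
    proof (rule diagonalizable_if_eigenbasis[of S D])
      show "invertible S"
        using ps by (simp add: SD invertible_det_nz det_2)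
      show "M ** S = S ** D"
        using True by (simp add: SD vec_eq_iff forall_2 matrix_matrix_mult_def sum_2 algebra_simps flip: pqrs)
    qed (simp add: SD diagonal_matrix_def forall_2)
  qed
qed

text \<open>
  The discriminant is continuous in \<open>\<epsilon>\<close> and non-zero at \<open>\<epsilon> = 0\<close>.
\<close>
lemma exists_diagonalizable_if_distinct:
  fixes D E :: "complex^2^2"
  assumes "diagonal_matrix D" and "D $ 1 $ 1 \<noteq> D $ 2 $ 2"
  shows "\<exists>\<epsilon>>0. diagonalizable (D + \<epsilon> *\<^sub>R E)"
proof -
  define disc where "disc \<epsilon> = ((D + \<epsilon> *\<^sub>R E) $ 1 $ 1 - (D + \<epsilon> *\<^sub>R E) $ 2 $ 2)\<^sup>2
      + 4 * (D + \<epsilon> *\<^sub>R E) $ 1 $ 2 * (D + \<epsilon> *\<^sub>R E) $ 2 $ 1" for \<epsilon>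
  have "isCont disc 0" unfolding disc_def by (intro continuous_intros)
  moreover have "disc 0 \<noteq> 0" using assms by (simp add: disc_def diagonal_matrix_def)
  ultimately have "\<forall>\<^sub>F \<epsilon> in at 0. disc \<epsilon> \<noteq> 0"
    unfolding isCont_def by (rule tendsto_imp_eventually_ne)
  hence "\<forall>\<^sub>F \<epsilon> in at_right 0. disc \<epsilon> \<noteq> 0"
    by (rule filter_leD[OF at_le, rotated]) simp
  moreover have "\<forall>\<^sub>F \<epsilon> in at_right (0::real). \<epsilon> > 0" by (rule eventually_at_right_less)
  ultimately have "\<forall>\<^sub>F \<epsilon> in at_right 0. disc \<epsilon> \<noteq> 0 \<and> \<epsilon> > 0" by (rule eventually_conj)
  from eventually_happens[OF this] obtain \<epsilon> where "disc \<epsilon> \<noteq> 0" "\<epsilon> > 0" by auto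
  thus ?thesis 
    using diagonalizable_if_discriminant_nonzero[of "D + \<epsilon> *\<^sub>R E"] unfolding disc_def by blast
qed

section \<open>Resonance integrals\<close>

lemma has_integral_exp_period:
  fixes T :: real and n :: int
  assumes T: "T > 0"
  shows "((\<lambda>t. exp (2 * of_real pi * \<i> / of_real T * of_int n * of_real t)) has_integral
           (if n = 0 then of_real T else 0)) {0..T}"
proof (cases "n = 0")
  case True
  thus ?thesis using has_integral_const_real[of "1::complex" 0 T] T by (simp add: scaleR_conv_of_real)
next
  case False
  define w where "w = 2 * of_real pi * \<i> / complex_of_real T * of_int n"
  have w: "w \<noteq> 0" using False T by (simp add: w_def)
  have "((\<lambda>t. exp (w * of_real t)) has_integral exp (w * of_real T) / w - exp (w * of_real 0) / w) {0..T}"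
  proof (rule fundamental_theorem_of_calculus)
    fix t
    show "((\<lambda>t. exp (w * of_real t) / w) has_vector_derivative exp (w * of_real t)) (at t within {0..T})"
      by (rule has_vector_derivative_at_within, rule has_vector_derivative_real_field)
         (use w in \<open>auto intro!: derivative_eq_intros\<close>)
  qed (use T in simp)
  moreover have "exp (w * of_real T) = 1"
  proof -
    have "w * of_real T = of_real (2 * of_int n * pi) * \<i>" using T by (simp add: w_def)
    thus ?thesis by (subst exp_eq_1) auto
  qed
  ultimately show ?thesis using False by (simp add: w_def)
qed

text \<open>
  The integral over one period of \<open>exp (2 \<pi> \<i> m t / T) cos (2 \<pi> a t / T + \<phi>)\<close>: a Fourier
  coefficient of a shifted cosine.
\<close>
definition resonance :: "real \<Rightarrow> int \<Rightarrow> nat \<Rightarrow> real \<Rightarrow> complex" where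
  "resonance T m a \<phi> = of_real T / 2 * 
     ((if m + int a = 0 then cis \<phi> else 0) + (if m - int a = 0 then cis (- \<phi>) else 0))"

lemma resonance_eq_0_iff:
  assumes "T > 0" and "a > 0"
  shows "resonance T m a \<phi> = 0 \<longleftrightarrow> \<bar>m\<bar> \<noteq> int a"
  using assms by (auto simp: resonance_def)

lemma has_integral_resonance:
  assumes T: "T > 0"
  shows "((\<lambda>t. exp (2 * of_real pi * \<i> / of_real T * of_int m * of_real t) 
            * of_real (cos (2 * pi / T * real a * t + \<phi>))) has_integral resonance T m a \<phi>) {0..T}"
proof -
  define w where "w n t = exp (2 * of_real pi * \<i> / of_real T * of_int n * of_real t)" for n and t :: real
  have "((\<lambda>t. cis \<phi> / 2 * w (m + int a) t + cis (- \<phi>) / 2 * w (m - int a) t) has_integral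
      cis \<phi> / 2 * (if m + int a = 0 then of_real T else 0) 
      + cis (- \<phi>) / 2 * (if m - int a = 0 then of_real T else 0)) {0..T}"
    unfolding w_def by (intro has_integral_add has_integral_mult_right has_integral_exp_period T)
  moreover have "cis \<phi> / 2 * (if m + int a = 0 then of_real T else 0) 
      + cis (- \<phi>) / 2 * (if m - int a = 0 then of_real T else 0) = resonance T m a \<phi>"
    by (simp add: resonance_def algebra_simps)
  moreover have "cis \<phi> / 2 * w (m + int a) t + cis (- \<phi>) / 2 * w (m - int a) t =
      w m t * of_real (cos (2 * pi / T * real a * t + \<phi>))" for t
  proof -
    define u where "u = 2 * of_real pi * \<i> / complex_of_real T * of_real t"
    have c: "of_real (cos (2 * pi / T * real a * t + \<phi>)) = 
        (exp (u * of_nat a + \<i> * of_real \<phi>) + exp (- (u * of_nat a + \<i> * of_real \<phi>))) / (2::complex)"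
      unfolding cos_of_real[symmetric] cos_exp_eq by (simp add: u_def algebra_simps)
    have "w n t = exp (u * of_int n)" for n by (simp add: w_def u_def ac_simps)
    thus ?thesis
      unfolding c by (simp add: cis_conv_exp distrib_left right_diff_distrib exp_add exp_diff exp_minus)
         (simp add: field_simps)
  qed
  ultimately show ?thesis by (simp add: w_def)
qed

lemma has_integral_two_resonances:
  assumes "T > 0"
  shows "((\<lambda>t. exp (2 * of_real pi * \<i> / of_real T * of_int m * of_real t)
      * (p * of_real (osc_kappa T b \<phi> t) + q * of_real (osc_zeta T a t)))
        has_integral (p * resonance T m b \<phi> + q * resonance T m a 0)) {0..T}"
proof -
  have "((\<lambda>t. p * (exp (2 * of_real pi * \<i> / of_real T * of_int m * of_real t) 
            * of_real (cos (2 * pi / T * real b * t + \<phi>))) 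
       + q * (exp (2 * of_real pi * \<i> / of_real T * of_int m * of_real t) 
            * of_real (cos (2 * pi / T * real a * t + 0))))
        has_integral (p * resonance T m b \<phi> + q * resonance T m a 0)) {0..T}"
    by (intro has_integral_add has_integral_mult_right has_integral_resonance assms)
  thus ?thesis by (simp add: osc_kappa_def osc_zeta_def algebra_simps)
qed

text \<open>
  Where \<open>a \<noteq> b\<close> enters: with equal frequencies the two contributions could cancel in one
  off-diagonal entry of \<open>F\<^sub>1\<close> without doing so in the other.
\<close>
lemma two_resonances_eq_0_iff:
  assumes "T > 0" "a > 0" "b > 0" "a \<noteq> b" "p \<noteq> 0" "q \<noteq> 0"
  shows "p * resonance T m b \<phi> + q * resonance T m a 0 = 0 \<longleftrightarrow> \<bar>m\<bar> \<noteq> int a \<and> \<bar>m\<bar> \<noteq> int b"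
  using assms resonance_eq_0_iff[of T a m 0] resonance_eq_0_iff[of T b m \<phi>]
  by (cases "\<bar>m\<bar> = int a"; cases "\<bar>m\<bar> = int b") auto

section \<open>The modulated oscillator\<close>

lemma osc_A0_nth:
  "osc_A0 c k $ 1 $ 1 = - ((of_real c + osc_alpha c k) / 2)" "osc_A0 c k $ 1 $ 2 = 0"
  "osc_A0 c k $ 2 $ 1 = 0" "osc_A0 c k $ 2 $ 2 = - ((of_real c - osc_alpha c k) / 2)"
  by (simp_all add: osc_A0_def Let_def)

text \<open>
  Each entry is written as \<open>p \<kappa> + q \<zeta>\<close> with constants \<open>p\<close> and \<open>q\<close>, the form in which the
  resonance integrals apply.
\<close>
lemma osc_A1_nth:
  fixes T c k \<phi> t :: real and a b :: nat
  defines "\<gamma> \<equiv> complex_of_real c" and "\<alpha> \<equiv> osc_alpha c k"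
    and "\<zeta> \<equiv> complex_of_real (osc_zeta T a t)" and "\<kappa> \<equiv> complex_of_real (osc_kappa T b \<phi> t)"
  shows "osc_A1 T a b c k \<phi> t $ 1 $ 1 = 1 / \<alpha> * \<kappa> + (- 1 - \<gamma> / \<alpha>) / 2 * \<zeta>"
    and "osc_A1 T a b c k \<phi> t $ 1 $ 2 = (\<gamma> + \<alpha>)\<^sup>2 / (4 * of_real k) / \<alpha> * \<kappa> + (- 1 - \<gamma> / \<alpha>) / 2 * \<zeta>"
    and "osc_A1 T a b c k \<phi> t $ 2 $ 1 = (\<gamma> - \<alpha>)\<^sup>2 / (4 * of_real k) / \<alpha> * \<kappa> + (- 1 + \<gamma> / \<alpha>) / 2 * \<zeta>"
    and "osc_A1 T a b c k \<phi> t $ 2 $ 2 = - 1 / \<alpha> * \<kappa> + (- 1 + \<gamma> / \<alpha>) / 2 * \<zeta>"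
  unfolding assms osc_A1_def Let_def vector_add_component mat_mult_nth vector_2
  by (simp_all add: ac_simps)

lemma continuous_on_osc_A1: "continuous_on S (osc_A1 T a b c k \<phi>)"
proof -
  have entry: "continuous_on S (\<lambda>t. p * of_real (osc_kappa T b \<phi> t) + q * of_real (osc_zeta T a t))"
    for p q :: complex
    unfolding osc_kappa_def osc_zeta_def by (intro continuous_intros)
  have "continuous_on S (\<lambda>t. osc_A1 T a b c k \<phi> t $ i $ j)" for i j
  proof -
    consider "i = 1" "j = 1" | "i = 1" "j = 2" | "i = 2" "j = 1" | "i = 2" "j = 2"
      using exhaust_2[of i] exhaust_2[of j] by blast
    thus ?thesis by cases (simp_all only: osc_A1_nth entry)
  qed
  hence "continuous_on S (\<lambda>t. \<chi> i j. osc_A1 T a b c k \<phi> t $ i $ j)"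
    by (intro continuous_on_vec_lambda)
  thus ?thesis by simp
qed

text \<open>
  The off-diagonal coefficients are multiples of \<open>c + \<alpha>\<close> and \<open>c - \<alpha>\<close>, whose product is
  \<open>4 k\<close>; this is how \<open>k \<noteq> 0\<close> guarantees that no resonant contribution degenerates.
\<close>
theorem lemma4p15:
  fixes c k \<phi> T :: real and a b :: nat
  assumes "c > 0" and "k > 0" and "c\<^sup>2 \<noteq> 4 * k"
    and "T > 0"
    and "a > 0" and "b > 0" and "coprime a b"
    and "a \<noteq> b"
  shows "\<not> first_order_asymptotic_exceptional_point T (osc_A0 c k) (osc_A1 T a b c k \<phi>)"
proof
  assume "first_order_asymptotic_exceptional_point T (osc_A0 c k) (osc_A1 T a b c k \<phi>)"
  then obtain Fc where expansion: "floquet_exponent_expansion T (osc_A0 c k) (osc_A1 T a b c k \<phi>) Fc"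
    and defective: "\<And>\<epsilon>. \<epsilon> > 0 \<Longrightarrow> \<not> diagonalizable (Fc 0 + \<epsilon> *\<^sub>R Fc 1)"
    unfolding first_order_asymptotic_exceptional_point_def by blast
  define \<alpha> \<gamma> where "\<alpha> = osc_alpha c k" and "\<gamma> = complex_of_real c"
  have \<alpha>2: "\<alpha>\<^sup>2 = \<gamma>\<^sup>2 - 4 * of_real k"
    by (simp add: \<alpha>_def \<gamma>_def osc_alpha_def)
  have \<alpha>: "\<alpha> \<noteq> 0"
  proof
    assume "\<alpha> = 0"
    hence "complex_of_real (c\<^sup>2) = complex_of_real (4 * k)" using \<alpha>2 by (simp add: \<gamma>_def)
    thus False using assms(3) by (simp only: of_real_eq_iff)
  qed
  have "(\<gamma> + \<alpha>) * (\<gamma> - \<alpha>) = 4 * of_real k"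
    using \<alpha>2 by (simp add: algebra_simps power2_eq_square)
  hence sum_diff: "\<gamma> + \<alpha> \<noteq> 0" "\<gamma> - \<alpha> \<noteq> 0"
    using assms(2) by (metis mult_eq_0_iff of_real_eq_0_iff less_irrefl zero_neq_numeral)+
  have fold: "folding T (osc_A0 c k) (Fc 0)"
    using expansion by (simp add: floquet_exponent_expansion_def)
  hence diag: "diagonal_matrix (Fc 0)" by (simp add: folding_def)
  \<comment> \<open>Otherwise small \<open>\<epsilon>\<close> would give diagonalizable matrices.\<close>
  have eq: "Fc 0 $ 1 $ 1 = Fc 0 $ 2 $ 2"
    using exists_diagonalizable_if_distinct[OF diag] defective by blast
  define f where "f = Fc 0 $ 1 $ 1"
  have scalar: "Fc 0 = mat f"
    using diag eq by (simp add: vec_eq_iff forall_2 mat_nth f_def diagonal_matrix_def)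
  obtain m :: int where m: "\<alpha> = 2 * of_real pi * \<i> / of_real T * of_int m"
  proof -
    obtain m1 m2 :: int where 
      "osc_A0 c k $ 1 $ 1 - Fc 0 $ 1 $ 1 = 2 * of_real pi * \<i> / of_real T * of_int m1"
      "osc_A0 c k $ 2 $ 2 - Fc 0 $ 2 $ 2 = 2 * of_real pi * \<i> / of_real T * of_int m2"
      using fold unfolding folding_def by blast
    moreover have "\<alpha> = (osc_A0 c k $ 2 $ 2 - Fc 0 $ 2 $ 2) - (osc_A0 c k $ 1 $ 1 - Fc 0 $ 1 $ 1)"
      unfolding eq osc_A0_nth \<alpha>_def by (simp add: field_simps)
    ultimately have "\<alpha> = 2 * of_real pi * \<i> / of_real T * of_int (m2 - m1)"
      by (simp add: right_diff_distrib)
    thus thesis by (rule that)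
  qed
  have "diagonal_matrix (osc_A0 c k)"
    by (simp add: diagonal_matrix_def forall_2 osc_A0_nth)
  note F1 = first_order_floquet_exponent[OF expansion assms(4) this continuous_on_osc_A1 scalar]
  have resonances: "T *\<^sub>R Fc 1 $ i $ j = p * resonance T n b \<phi> + q * resonance T n a 0"
    if "\<And>t. osc_A1 T a b c k \<phi> t $ i $ j 
           = p * of_real (osc_kappa T b \<phi> t) + q * of_real (osc_zeta T a t)"
      and "osc_A0 c k $ j $ j - osc_A0 c k $ i $ i = 2 * of_real pi * \<i> / of_real T * of_int n" 
    for i j p q n
    using F1[of j i] has_integral_two_resonances[OF assms(4), of n p b \<phi> q a]
    unfolding that by (rule has_integral_unique)
  have gap: "osc_A0 c k $ 2 $ 2 - osc_A0 c k $ 1 $ 1 = 2 * of_real pi * \<i> / of_real T * of_int m"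
      "osc_A0 c k $ 1 $ 1 - osc_A0 c k $ 2 $ 2 = 2 * of_real pi * \<i> / of_real T * of_int (- m)"
    using m by (simp_all add: osc_A0_nth field_simps flip: \<alpha>_def)
  \<comment> \<open>The diagonal entries see the frequency 0, where cosines average out.\<close>
  have no_resonance: "resonance T 0 b \<phi> = 0" "resonance T 0 a 0 = 0"
    using assms by (simp_all add: resonance_eq_0_iff)
  have "T *\<^sub>R Fc 1 $ 1 $ 1 = 0"
    by (subst resonances[OF osc_A1_nth(1), where n = 0]) (simp_all add: no_resonance)
  moreover have "T *\<^sub>R Fc 1 $ 2 $ 2 = 0"
    by (subst resonances[OF osc_A1_nth(4), where n = 0]) (simp_all add: no_resonance)
  ultimately have diag0: "Fc 1 $ 1 $ 1 = 0" "Fc 1 $ 2 $ 2 = 0" using assms(4) by auto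
  have "- 1 - \<gamma> / \<alpha> \<noteq> 0" "- 1 + \<gamma> / \<alpha> \<noteq> 0"
    using sum_diff \<alpha> by (auto simp: field_simps)
  note nonzero = this sum_diff \<alpha>
  have "Fc 1 $ 1 $ 2 = 0 \<longleftrightarrow> T *\<^sub>R Fc 1 $ 1 $ 2 = 0" using assms(4) by simp
  also have "\<dots> \<longleftrightarrow> \<bar>m\<bar> \<noteq> int a \<and> \<bar>m\<bar> \<noteq> int b"
    unfolding resonances[OF osc_A1_nth(2) gap(1)] using assms nonzero
    by (intro two_resonances_eq_0_iff) (auto simp flip: \<alpha>_def \<gamma>_def)
  also have "\<dots> \<longleftrightarrow> \<bar>- m\<bar> \<noteq> int a \<and> \<bar>- m\<bar> \<noteq> int b" by simp
  also have "\<dots> \<longleftrightarrow> T *\<^sub>R Fc 1 $ 2 $ 1 = 0"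
    unfolding resonances[OF osc_A1_nth(3) gap(2)] using assms nonzero
    by (intro two_resonances_eq_0_iff[symmetric]) (auto simp flip: \<alpha>_def \<gamma>_def)
  also have "\<dots> \<longleftrightarrow> Fc 1 $ 2 $ 1 = 0" using assms(4) by simp
  finally have both: "Fc 1 $ 1 $ 2 = 0 \<longleftrightarrow> Fc 1 $ 2 $ 1 = 0" .
  \<comment> \<open>Up to the scalar \<open>f\<close> the matrix has zero diagonal: it is zero, or its discriminant is four
     times the non-zero product of the off-diagonal entries. So already \<open>\<epsilon> = 1\<close> contradicts defectiveness.\<close>
  have "diagonalizable (Fc 0 + 1 *\<^sub>R Fc 1)"
  proof (cases "Fc 1 $ 1 $ 2 = 0")
    case True
    with both show ?thesis
      by (intro diagonalizable_if_diagonal) (simp add: scalar diagonal_matrix_def forall_2 mat_nth)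
  next
    case False
    with both diag0 show ?thesis
      by (intro diagonalizable_if_discriminant_nonzero) (simp add: scalar mat_nth)
  qed
  thus False using defective[of 1] by simp
qed

end
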